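(* Let $J$ be a tamed almost complex structure on a $4$-dimensional unimodular real Lie algebra $\mathfrak{g}$. Then the $J$-compatible cone $\mathcal{K}_J^c(\mathfrak{g})$ is a connected component of $$\{e\in H_J^+(\mathfrak{g}) \mid e^2>0\},$$ and the $J$-tamed cone is $$\mathcal{K}_J^t(\mathfrak{g})=\mathcal{K}_J^c(\mathfrak{g})+H_J^-(\mathfrak{g}).$$
   Context: $\mathfrak{g}$ is unimodular if $\mathrm{tr}(\mathrm{ad}_\xi)=0$ for all $\xi\in\mathfrak{g}$. $H^*(\mathfrak{g})$ is the Chevalley–Eilenberg cohomology of $(\Lambda^*(\mathfrak{g}^* ),d)$, $d\phi(u,v)=-\phi([u,v])$ on $1$-forms. An almost complex structure is a linear automorphism $J$ of the vector space $\mathfrak{g}$ with $J^2=-\mathrm{id}$; $\mathfrak{g}$ carries the orientation induced by $J$. Fix a nonzero $\zeta\in\Lambda^4(\mathfrak{g})$ inducing the orientation; since $\mathfrak{g}$ is unimodular, the pairing $(\alpha,\beta)\mapsto(\alpha\wedge\beta)(\zeta)$ on closed $2$-forms descends to $H^2(\mathfrak{g})$, and $e^2$ denotes the pairing of $e$ with itself. $\Lambda_J^{\pm}(\mathfrak{g}^* )$ are the $\pm1$-eigenspaces of $\alpha(\cdot,\cdot)\mapsto\alpha(J\cdot,J\cdot)$ on $\Lambda^2(\mathfrak{g}^* )$, and $H_J^{\pm}(\mathfrak{g})\subset H^2(\mathfrak{g})$ is the subspace of classes that can be represented by a closed form in $\Lambda_J^\pm(\mathfrak{g}^* )$. A closed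 $2$-form $\omega$ on $\mathfrak{g}$ is $J$-tamed if $\omega(v,Jv)>0$ for all nonzero $v\in\mathfrak{g}$, and $J$-compatible if moreover $\omega\in\Lambda_J^+(\mathfrak{g}^* )$. $J$ is tamed if there is a $J$-tamed form. Set $\mathcal{K}_J^t(\mathfrak{g})=\{[\omega]\in H^2(\mathfrak{g})\mid\omega\text{ is }J\text{-tamed}\}$ and $\mathcal{K}_J^c(\mathfrak{g})=\{[\omega]\in H_J^+(\mathfrak{g})\mid\omega\text{ is }J\text{-compatible}\}$. *)

theory Defs
  imports "HOL-Analysis.Analysis" "HOL-Library.Function_Algebras"
begin

section \<open>Lie algebras\<close>

text \<open>A real Lie algebra is a bracket on a type of class \<open>real_vector\<close>; the statement adds
  \<open>dim UNIV = 4\<close>, which forces finite dimension since \<open>dim\<close> is \<open>0\<close> on infinite-dimensional spaces.\<close>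

definition lie_bracket :: "('a::real_vector \<Rightarrow> 'a \<Rightarrow> 'a) \<Rightarrow> bool" where
  "lie_bracket br \<longleftrightarrow> bilinear br \<and> (\<forall>x. br x x = 0) \<and>
     (\<forall>x y z. br x (br y z) + br y (br z x) + br z (br x y) = 0)"

text \<open>Only meaningful in finite dimension, where the value does not depend on the chosen basis
  (\<open>lin_trace_eq\<close> below).\<close>

definition lin_trace :: "('a::real_vector \<Rightarrow> 'a) \<Rightarrow> real" where
  "lin_trace f = (let B = (SOME B. independent B \<and> span B = UNIV)
                  in \<Sum>b\<in>B. representation B (f b) b)"

definition unimodular :: "('a::real_vector \<Rightarrow> 'a \<Rightarrow> 'a) \<Rightarrow> bool" where
  "unimodular br \<longleftrightarrow> (\<forall>\<xi>. lin_trace (br \<xi>) = 0)"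

lemma lin_trace_eq:
  fixes f :: "'a::real_vector \<Rightarrow> 'a"
  assumes f: "linear f" and B: "finite B" "independent B" "span B = UNIV"
  shows "lin_trace f = (\<Sum>b\<in>B. representation B (f b) b)"
proof -
  define C where "C = (SOME B::'a set. independent B \<and> span B = UNIV)"
  have C: "independent C \<and> span C = UNIV"
    unfolding C_def by (rule someI[where x = B]) (use B in simp)
  have finC: "finite C"
    using independent_span_bound[OF B(1)] B(3) C by auto
  have exp: "(\<Sum>d\<in>D. representation D v d *\<^sub>R d) = v"
    if "finite D" "independent D" "span D = UNIV" for D and v :: 'a
    using real_vector.sum_representation_eq[OF that(2) _ that(1)] that by simp
  have rep_lin: "representation D (\<Sum>e\<in>E. a e *\<^sub>R g e) d = (\<Sum>e\<in>E. a e * representation D (g e) d)"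
    if "independent D" "span D = UNIV"
    for D E :: "'a set" and a :: "'a \<Rightarrow> real" and g :: "'a \<Rightarrow> 'a" and d
  proof -
    have "representation D (\<Sum>e\<in>E. a e *\<^sub>R g e) = (\<lambda>b. \<Sum>e\<in>E. representation D (a e *\<^sub>R g e) b)"
      by (rule real_vector.representation_sum) (use that in auto)
    then show ?thesis
      using that by (simp add: real_vector.representation_scale)
  qed
  have "(\<Sum>b\<in>B. representation B (f b) b)
      = (\<Sum>b\<in>B. \<Sum>c\<in>C. representation C (f b) c * representation B c b)"
    using rep_lin[of B "\<lambda>c. representation C (f _) c" "\<lambda>c. c" C] exp[OF finC] B C
    by (metis (no_types, lifting) sum.cong)
  also have "\<dots> = (\<Sum>c\<in>C. \<Sum>b\<in>B. representation B c b * representation C (f b) c)"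
    by (subst sum.swap) (simp add: mult.commute)
  also have "\<dots> = (\<Sum>c\<in>C. representation C (\<Sum>b\<in>B. representation B c b *\<^sub>R f b) c)"
    using rep_lin C by simp
  also have "\<dots> = (\<Sum>c\<in>C. representation C (f (\<Sum>b\<in>B. representation B c b *\<^sub>R b)) c)"
    using f by (simp add: linear_sum linear_scale)
  also have "\<dots> = (\<Sum>c\<in>C. representation C (f c) c)"
    using exp[OF B] by simp
  finally show ?thesis
    by (simp add: lin_trace_def C_def[symmetric])
qed

section \<open>Chevalley--Eilenberg cohomology in degree two\<close>

type_synonym 'a form2 = "'a \<Rightarrow> 'a \<Rightarrow> real"
type_synonym 'a form3 = "'a \<Rightarrow> 'a \<Rightarrow> 'a \<Rightarrow> real"
type_synonym 'a form4 = "'a \<Rightarrow> 'a \<Rightarrow> 'a \<Rightarrow> 'a \<Rightarrow> real"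

definition Lambda2 :: "'a::real_vector form2 set" where
  "Lambda2 = {\<alpha>. bilinear \<alpha> \<and> (\<forall>v. \<alpha> v v = 0)}"

text \<open>For a multilinear map, vanishing on equal adjacent arguments already means alternating.\<close>

definition Lambda4 :: "'a::real_vector form4 set" where
  "Lambda4 = {\<eta>.
     (\<forall>v w x. linear (\<lambda>u. \<eta> u v w x)) \<and> (\<forall>u w x. linear (\<lambda>v. \<eta> u v w x)) \<and>
     (\<forall>u v x. linear (\<lambda>w. \<eta> u v w x)) \<and> (\<forall>u v w. linear (\<lambda>x. \<eta> u v w x)) \<and>
     (\<forall>u v w. \<eta> u u v w = 0 \<and> \<eta> u v v w = 0 \<and> \<eta> u v w w = 0)}"

text \<open>\<open>d2\<close> is the value on 2-forms of the antiderivation of the exterior algebra extending \<open>d1\<close>.\<close>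

definition d1 :: "('a::real_vector \<Rightarrow> 'a \<Rightarrow> 'a) \<Rightarrow> ('a \<Rightarrow> real) \<Rightarrow> 'a form2" where
  "d1 br \<phi> = (\<lambda>u v. - \<phi> (br u v))"

definition d2 :: "('a::real_vector \<Rightarrow> 'a \<Rightarrow> 'a) \<Rightarrow> 'a form2 \<Rightarrow> 'a form3" where
  "d2 br \<alpha> = (\<lambda>u v w. - \<alpha> (br u v) w + \<alpha> (br u w) v - \<alpha> (br v w) u)"

definition closed2 :: "('a::real_vector \<Rightarrow> 'a \<Rightarrow> 'a) \<Rightarrow> 'a form2 set" where
  "closed2 br = {\<alpha> \<in> Lambda2. d2 br \<alpha> = 0}"

definition cohomologous :: "('a::real_vector \<Rightarrow> 'a \<Rightarrow> 'a) \<Rightarrow> ('a form2 \<times> 'a form2) set" where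
  "cohomologous br = {(\<alpha>, \<beta>). \<alpha> \<in> closed2 br \<and> \<beta> \<in> closed2 br \<and>
     (\<exists>\<phi>. linear \<phi> \<and> \<beta> = \<alpha> + d1 br \<phi>)}"

definition cls :: "('a::real_vector \<Rightarrow> 'a \<Rightarrow> 'a) \<Rightarrow> 'a form2 \<Rightarrow> 'a form2 set" where
  "cls br \<alpha> = cohomologous br `` {\<alpha>}"

definition H2 :: "('a::real_vector \<Rightarrow> 'a \<Rightarrow> 'a) \<Rightarrow> 'a form2 set set" where
  "H2 br = closed2 br // cohomologous br"

lemma equiv_cohomologous: "equiv (closed2 br) (cohomologous br)"
proof (rule equivI)
  show "cohomologous br \<subseteq> closed2 br \<times> closed2 br"
    by (auto simp: cohomologous_def)
  show "refl_on (closed2 br) (cohomologous br)"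
    by (auto simp: refl_on_def cohomologous_def d1_def fun_eq_iff intro!: exI[of _ "\<lambda>_. 0"] linearI)
  show "sym (cohomologous br)"
  proof (rule symI)
    fix \<alpha> \<beta> assume "(\<alpha>, \<beta>) \<in> cohomologous br"
    then obtain \<phi> where "\<alpha> \<in> closed2 br" "\<beta> \<in> closed2 br" "linear \<phi>" "\<beta> = \<alpha> + d1 br \<phi>"
      by (auto simp: cohomologous_def)
    moreover from this have "\<alpha> = \<beta> + d1 br (\<lambda>x. - \<phi> x)" "linear (\<lambda>x. - \<phi> x)"
      by (simp_all add: d1_def fun_eq_iff linear_compose_neg)
    ultimately show "(\<beta>, \<alpha>) \<in> cohomologous br"
      unfolding cohomologous_def by blast
  qed
  show "trans (cohomologous br)"
  proof (rule transI)
    fix \<alpha> \<beta> \<gamma> assume "(\<alpha>, \<beta>) \<in> cohomologous br" "(\<beta>, \<gamma>) \<in> cohomologous br"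
    then obtain \<phi> \<psi> where "\<alpha> \<in> closed2 br" "\<gamma> \<in> closed2 br" "linear \<phi>" "linear \<psi>"
        "\<gamma> = (\<alpha> + d1 br \<phi>) + d1 br \<psi>"
      by (auto simp: cohomologous_def)
    moreover from this have "\<gamma> = \<alpha> + d1 br (\<lambda>x. \<phi> x + \<psi> x)" "linear (\<lambda>x. \<phi> x + \<psi> x)"
      by (simp_all add: d1_def fun_eq_iff linear_compose_add)
    ultimately show "(\<alpha>, \<gamma>) \<in> cohomologous br"
      unfolding cohomologous_def by blast
  qed
qed

text \<open>The type \<open>'a form2\<close> carries the topology of pointwise convergence. In finite dimension the
  closed 2-forms are a finite-dimensional subspace, on which this is the usual vector space
  topology; \<open>H2\<close> gets the quotient topology, again the usual one.\<close>

definition H2_topology :: "('a::real_vector \<Rightarrow> 'a \<Rightarrow> 'a) \<Rightarrow> 'a form2 set topology" where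
  "H2_topology br = topology (\<lambda>U. U \<subseteq> H2 br \<and>
     openin (top_of_set (closed2 br)) {\<alpha> \<in> closed2 br. cls br \<alpha> \<in> U})"

lemma openin_H2_topology:
  "openin (H2_topology br) U \<longleftrightarrow> U \<subseteq> H2 br \<and>
     openin (top_of_set (closed2 br)) {\<alpha> \<in> closed2 br. cls br \<alpha> \<in> U}"
proof -
  have "istopology (\<lambda>U. U \<subseteq> H2 br \<and>
     openin (top_of_set (closed2 br)) {\<alpha> \<in> closed2 br. cls br \<alpha> \<in> U})" (is "istopology ?L")
    unfolding istopology_def
  proof (intro conjI allI impI)
    fix S T assume "?L S" "?L T"
    moreover have "{\<alpha> \<in> closed2 br. cls br \<alpha> \<in> S \<inter> T}
        = {\<alpha> \<in> closed2 br. cls br \<alpha> \<in> S} \<inter> {\<alpha> \<in> closed2 br. cls br \<alpha> \<in> T}" by auto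
    ultimately show "S \<inter> T \<subseteq> H2 br"
      "openin (top_of_set (closed2 br)) {\<alpha> \<in> closed2 br. cls br \<alpha> \<in> S \<inter> T}"
      by (auto intro: openin_Int)
  next
    fix \<K> assume K: "\<forall>K\<in>\<K>. ?L K"
    have "{\<alpha> \<in> closed2 br. cls br \<alpha> \<in> \<Union>\<K>} = (\<Union>K\<in>\<K>. {\<alpha> \<in> closed2 br. cls br \<alpha> \<in> K})" by auto
    with K show "\<Union>\<K> \<subseteq> H2 br"
      "openin (top_of_set (closed2 br)) {\<alpha> \<in> closed2 br. cls br \<alpha> \<in> \<Union>\<K>}"
      by auto
  qed
  then show ?thesis
    by (simp add: H2_topology_def)
qed

lemma quotient_map_cls: "quotient_map (top_of_set (closed2 br)) (H2_topology br) (cls br)"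
proof -
  have im: "cls br ` closed2 br = H2 br"
    by (auto simp: H2_def quotient_def cls_def)
  have "openin (H2_topology br) (H2 br)"
    unfolding openin_H2_topology using im by (auto simp: image_iff Collect_conj_eq)
      (metis (no_types, lifting) Collect_mem_eq Int_absorb2 im imageI mem_Collect_eq
        openin_subtopology_self subsetI)
  then have "topspace (H2_topology br) = H2 br"
    by (metis openin_H2_topology openin_subset openin_topspace subset_antisym)
  then show ?thesis
    by (auto simp: quotient_map_def im openin_H2_topology)
qed

section \<open>Almost complex structures, orientation and the pairing\<close>

definition almost_complex :: "('a::real_vector \<Rightarrow> 'a) \<Rightarrow> bool" where
  "almost_complex J \<longleftrightarrow> linear J \<and> (\<forall>v. J (J v) = - v)"

text \<open>In dimension four, an element of \<open>\<Lambda>\<^sup>4(\<gg>)\<close> is the same as a linear functional on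
  \<open>\<Lambda>\<^sup>4(\<gg>\<^sup>*)\<close>, and \<open>u \<and> v \<and> w \<and> x\<close> is evaluation at \<open>(u, v, w, x)\<close>. The orientation induced by
  \<open>J\<close> is the one for which \<open>(u, J u, w, J w)\<close> is a positive basis. Hence \<open>\<zeta>\<close> is nonzero and induces
  it iff \<open>\<zeta> = c (u \<and> J u \<and> w \<and> J w)\<close> with \<open>c > 0\<close>. Values of \<open>\<zeta>\<close> outside \<open>Lambda4\<close> are irrelevant.\<close>

definition J_positive :: "('a::real_vector \<Rightarrow> 'a) \<Rightarrow> ('a form4 \<Rightarrow> real) \<Rightarrow> bool" where
  "J_positive J \<zeta> \<longleftrightarrow> (\<exists>u w c. span {u, J u, w, J w} = UNIV \<and> c > 0 \<and>
     (\<forall>\<eta>\<in>Lambda4. \<zeta> \<eta> = c * \<eta> u (J u) w (J w)))"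

definition wedge22 :: "'a form2 \<Rightarrow> 'a form2 \<Rightarrow> 'a form4" where
  "wedge22 \<alpha> \<beta> = (\<lambda>u v w x.
      \<alpha> u v * \<beta> w x - \<alpha> u w * \<beta> v x + \<alpha> u x * \<beta> v w
    + \<alpha> v w * \<beta> u x - \<alpha> v x * \<beta> u w + \<alpha> w x * \<beta> u v)"

text \<open>For unimodular \<open>\<gg>\<close> the set below is a singleton, so this is the induced pairing on classes.\<close>

definition pairing :: "('a form4 \<Rightarrow> real) \<Rightarrow> 'a form2 set \<Rightarrow> 'a form2 set \<Rightarrow> real" where
  "pairing \<zeta> e f = the_elem (\<Union>\<alpha>\<in>e. \<Union>\<beta>\<in>f. {\<zeta> (wedge22 \<alpha> \<beta>)})"

section \<open>Invariant and anti-invariant classes, tamed and compatible cones\<close>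

definition Lambda_plus :: "('a::real_vector \<Rightarrow> 'a) \<Rightarrow> 'a form2 set" where
  "Lambda_plus J = {\<alpha> \<in> Lambda2. \<forall>u v. \<alpha> (J u) (J v) = \<alpha> u v}"

definition Lambda_minus :: "('a::real_vector \<Rightarrow> 'a) \<Rightarrow> 'a form2 set" where
  "Lambda_minus J = {\<alpha> \<in> Lambda2. \<forall>u v. \<alpha> (J u) (J v) = - \<alpha> u v}"

definition H_plus :: "('a::real_vector \<Rightarrow> 'a \<Rightarrow> 'a) \<Rightarrow> ('a \<Rightarrow> 'a) \<Rightarrow> 'a form2 set set" where
  "H_plus br J = cls br ` (closed2 br \<inter> Lambda_plus J)"

definition H_minus :: "('a::real_vector \<Rightarrow> 'a \<Rightarrow> 'a) \<Rightarrow> ('a \<Rightarrow> 'a) \<Rightarrow> 'a form2 set set" where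
  "H_minus br J = cls br ` (closed2 br \<inter> Lambda_minus J)"

definition tamed_form :: "('a::real_vector \<Rightarrow> 'a \<Rightarrow> 'a) \<Rightarrow> ('a \<Rightarrow> 'a) \<Rightarrow> 'a form2 \<Rightarrow> bool" where
  "tamed_form br J \<omega> \<longleftrightarrow> \<omega> \<in> closed2 br \<and> (\<forall>v. v \<noteq> 0 \<longrightarrow> \<omega> v (J v) > 0)"

definition compatible_form :: "('a::real_vector \<Rightarrow> 'a \<Rightarrow> 'a) \<Rightarrow> ('a \<Rightarrow> 'a) \<Rightarrow> 'a form2 \<Rightarrow> bool" where
  "compatible_form br J \<omega> \<longleftrightarrow> tamed_form br J \<omega> \<and> \<omega> \<in> Lambda_plus J"

definition tamed :: "('a::real_vector \<Rightarrow> 'a \<Rightarrow> 'a) \<Rightarrow> ('a \<Rightarrow> 'a) \<Rightarrow> bool" where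
  "tamed br J \<longleftrightarrow> (\<exists>\<omega>. tamed_form br J \<omega>)"

definition tamed_cone :: "('a::real_vector \<Rightarrow> 'a \<Rightarrow> 'a) \<Rightarrow> ('a \<Rightarrow> 'a) \<Rightarrow> 'a form2 set set" where
  "tamed_cone br J = {cls br \<omega> | \<omega>. tamed_form br J \<omega>}"

definition compatible_cone :: "('a::real_vector \<Rightarrow> 'a \<Rightarrow> 'a) \<Rightarrow> ('a \<Rightarrow> 'a) \<Rightarrow> 'a form2 set set" where
  "compatible_cone br J = {cls br \<omega> | \<omega>. compatible_form br J \<omega>}"

text \<open>Addition in the quotient is elementwise addition of cosets, so for sets of classes the sum
  \<open>A + B\<close> of \<open>HOL-Library.Set_Algebras\<close> (elementwise twice over) is the usual sum of subsets.\<close>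

lemma cls_add:
  assumes \<alpha>: "\<alpha> \<in> closed2 br" and \<beta>: "\<beta> \<in> closed2 br"
  shows "cls br \<alpha> + cls br \<beta> = cls br (\<alpha> + \<beta>)"
proof -
  have closed_add: "\<gamma> + \<delta> \<in> closed2 br" if "\<gamma> \<in> closed2 br" "\<delta> \<in> closed2 br" for \<gamma> \<delta>
  proof -
    have "bilinear (\<lambda>u v. \<gamma> u v + \<delta> u v)"
      using that by (simp add: closed2_def Lambda2_def bilinear_def linear_compose_add)
    moreover have "d2 br (\<gamma> + \<delta>) = d2 br \<gamma> + d2 br \<delta>"
      by (simp add: d2_def fun_eq_iff)
    ultimately show ?thesis
      using that by (simp add: closed2_def Lambda2_def plus_fun_def zero_fun_def)
  qed
  show ?thesis
  proof (intro equalityI subsetI)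
    fix \<gamma> assume "\<gamma> \<in> cls br \<alpha> + cls br \<beta>"
    then obtain \<alpha>' \<beta>' where *: "\<alpha>' \<in> cls br \<alpha>" "\<beta>' \<in> cls br \<beta>" "\<gamma> = \<alpha>' + \<beta>'"
      by (auto simp: set_plus_def)
    then obtain \<phi> \<psi> where "linear \<phi>" "linear \<psi>" "\<alpha>' = \<alpha> + d1 br \<phi>" "\<beta>' = \<beta> + d1 br \<psi>"
        "\<alpha>' \<in> closed2 br" "\<beta>' \<in> closed2 br"
      by (auto simp: cls_def cohomologous_def)
    moreover from this * have "\<gamma> \<in> closed2 br"
      by (metis closed_add)
    moreover from calculation * have "linear (\<lambda>x. \<phi> x + \<psi> x)"
        "\<gamma> = (\<alpha> + \<beta>) + d1 br (\<lambda>x. \<phi> x + \<psi> x)"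
      by (simp_all add: linear_compose_add d1_def fun_eq_iff)
    ultimately show "\<gamma> \<in> cls br (\<alpha> + \<beta>)"
      using closed_add[OF \<alpha> \<beta>] unfolding cls_def cohomologous_def by blast
  next
    fix \<gamma> assume "\<gamma> \<in> cls br (\<alpha> + \<beta>)"
    then obtain \<phi> where \<phi>: "linear \<phi>" "\<gamma> = (\<alpha> + \<beta>) + d1 br \<phi>" "\<gamma> \<in> closed2 br"
      by (auto simp: cls_def cohomologous_def)
    have neg: "- \<beta> \<in> closed2 br"
    proof -
      have "bilinear (\<lambda>u v. - \<beta> u v)"
        using \<beta> by (simp add: closed2_def Lambda2_def bilinear_def linear_compose_neg)
      moreover have "d2 br (- \<beta>) = - d2 br \<beta>"
        by (simp add: d2_def fun_eq_iff)
      ultimately show ?thesis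
        using \<beta> by (simp add: closed2_def Lambda2_def fun_Compl_def zero_fun_def)
    qed
    have "\<gamma> + - \<beta> \<in> closed2 br"
      using closed_add[OF \<phi>(3) neg] .
    moreover have eq: "\<gamma> + - \<beta> = \<alpha> + d1 br \<phi>"
      using \<phi>(2) by (simp add: fun_eq_iff)
    ultimately have "\<alpha> + d1 br \<phi> \<in> cls br \<alpha>"
      using \<alpha> \<phi>(1) unfolding cls_def cohomologous_def by auto
    moreover have "\<beta> \<in> cls br \<beta>"
      using equiv_class_self[OF equiv_cohomologous \<beta>] by (simp add: cls_def)
    moreover have "\<gamma> = (\<alpha> + d1 br \<phi>) + \<beta>"
      using \<phi>(2) by (simp add: fun_eq_iff)
    ultimately show "\<gamma> \<in> cls br \<alpha> + cls br \<beta>"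
      by (auto simp: set_plus_def)
  qed
qed

end

theory Submission
  imports Defs
begin

text \<open>
  Everything is linear algebra in the six-dimensional space \<open>\<Lambda>\<^sup>2\<close> with the intersection form
  \<open>q(\<alpha>, \<beta>) = (\<alpha> \<and> \<beta>)(u, J u, w, J w)\<close>, which has signature \<open>(3,3)\<close> and for which
  \<open>\<Lambda>\<^sup>+ \<oplus> \<Lambda>\<^sup>-\<close> is an orthogonal splitting: \<open>q\<close> is positive definite on the plane \<open>\<Lambda>\<^sup>-\<close> and Lorentzian,
  of signature \<open>(1,3)\<close>, on \<open>\<Lambda>\<^sup>+\<close>. A 2-form \<open>\<alpha>\<close> satisfies \<open>\<alpha>(v, J v) > 0\<close> for all \<open>v \<noteq> 0\<close> iff its
  \<open>\<Lambda>\<^sup>+\<close> component is timelike and points to the future (\<open>taming_iff_future\<close>).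

  The Lie algebra enters only through the space \<open>B\<close> of exact forms. By Stokes' formula for unimodular
  algebras (\<open>intersection_exact\<close>), the space of closed forms is \<open>B\<^sup>\<bottom>\<close> (\<open>closed2_iff\<close>); in
  particular \<open>B\<close> is isotropic. As \<open>q \<ge> 0\<close> on \<open>\<Lambda>\<^sup>-\<close>, the component \<open>b\<^sup>+\<close> of an exact form \<open>b\<close> has
  \<open>q(b\<^sup>+, b\<^sup>+) \<le> 0\<close>. In the case of equality \<open>b\<close> lies in \<open>\<Lambda>\<^sup>+\<close> and is null; but a taming form, being
  closed, is orthogonal to \<open>b\<close>, so the timelike component of the taming form is orthogonal to the
  null vector \<open>b\<close>, which forces \<open>b = 0\<close>. Hence \<open>q\<close> is negative definite on the projection \<open>B\<^sup>+\<close> of \<open>B\<close> to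
  \<open>\<Lambda>\<^sup>+\<close> (\<open>exact_invariant_coords_eq_0\<close>).

  Given a taming form \<open>\<omega>\<close>, one can therefore subtract from \<open>\<omega>\<^sup>+\<close> its orthogonal projection \<open>b\<^sup>+\<close> to
  \<open>B\<^sup>+\<close>. The rest \<open>\<alpha> = \<omega>\<^sup>+ - b\<^sup>+\<close> is orthogonal to \<open>B\<close>, hence closed; it is still timelike and
  future-directed because only a spacelike vector orthogonal to it was removed. So \<open>\<alpha>\<close> is a compatible
  form, and \<open>\<omega> - b = \<alpha> + (\<omega>\<^sup>- - b\<^sup>-)\<close> exhibits the class of \<open>\<omega>\<close> as the sum of a compatible class and a
  class in \<open>H\<^sub>J\<^sup>-\<close> (\<open>tamed_decomposition\<close>). Conversely, anti-invariant forms vanish on all pairs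
  \<open>(v, J v)\<close>, so adding one preserves tameness.

  Finally, fix a compatible form \<open>\<omega>\<close>. A class \<open>e \<in> H\<^sub>J\<^sup>+\<close> with \<open>e\<^sup>2 > 0\<close> is represented by a timelike vector
  of \<open>\<Lambda>\<^sup>+\<close>, whose product with \<open>[\<omega>]\<close> is nonzero, and positive exactly when the vector points to the
  future. So the compatible cone is cut out by \<open>e \<cdot> [\<omega>] > 0\<close> and its complement by \<open>e \<cdot> [\<omega>] < 0\<close>.
  Both are open, and the compatible cone is connected as the image of a convex set of forms
  (\<open>compatible_cone_in_connected_components\<close>).
\<close>

section \<open>Timelike vectors in a four-dimensional Lorentzian space\<close>

text \<open>The coordinates \<open>(a, b)\<close> are light-cone coordinates, so \<open>lorentz x x = 2 (a b - c\<^sup>2 - d\<^sup>2)\<close> has signature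
  \<open>(1,3)\<close> and positive vectors are timelike.\<close>

definition lorentz :: "real \<times> real \<times> real \<times> real \<Rightarrow> real \<times> real \<times> real \<times> real \<Rightarrow> real" where
  "lorentz = (\<lambda>(a, b, c, d) (a', b', c', d'). a * b' + b * a' - 2 * c * c' - 2 * d * d')"

definition future :: "(real \<times> real \<times> real \<times> real) set" where
  "future = {x. fst x > 0 \<and> lorentz x x > 0}"

lemma lorentz_sym: "lorentz x y = lorentz y x"
  by (auto simp: lorentz_def split: prod.splits)

lemma bilinear_lorentz: "bilinear lorentz"
  unfolding bilinear_def
  by (auto intro!: linearI simp: lorentz_def algebra_simps split: prod.splits)

text \<open>The orthogonal complement of a timelike vector is spacelike. For \<open>x = (a, b, c, d)\<close> and
  \<open>y = (a', b', c', d')\<close>, orthogonality turns \<open>a\<^sup>2 (c'\<^sup>2 + d'\<^sup>2 - a' b')\<close> into the sum of squares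
  \<open>(a c' - a' c)\<^sup>2 + (a d' - a' d)\<^sup>2 + a'\<^sup>2 (a b - c\<^sup>2 - d\<^sup>2)\<close>, with a positive coefficient in the last term.\<close>

lemma lorentz_orthogonal_future:
  assumes x: "x \<in> future" and orth: "lorentz x y = 0" and y: "lorentz y y \<ge> 0"
  shows "y = 0"
proof -
  obtain a b c d a' b' c' d' where [simp]: "x = (a, b, c, d)" "y = (a', b', c', d')"
    by (metis prod.collapse)
  have a: "a > 0" and ab: "a * b > c\<^sup>2 + d\<^sup>2"
    using x by (simp_all add: future_def lorentz_def power2_eq_square)
  have eq: "a * b' + b * a' = 2 * (c * c' + d * d')" and ge: "a' * b' \<ge> c'\<^sup>2 + d'\<^sup>2"
    using orth y by (simp_all add: lorentz_def power2_eq_square algebra_simps)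
  have "(a * c' - a' * c)\<^sup>2 + (a * d' - a' * d)\<^sup>2 + a'\<^sup>2 * (a * b - c\<^sup>2 - d\<^sup>2)
      = a\<^sup>2 * (c'\<^sup>2 + d'\<^sup>2) - a * a' * (2 * (c * c' + d * d')) + a'\<^sup>2 * a * b"
    by (simp add: power2_eq_square algebra_simps)
  also have "\<dots> = a\<^sup>2 * (c'\<^sup>2 + d'\<^sup>2 - a' * b')"
    unfolding eq[symmetric] by (simp add: power2_eq_square algebra_simps)
  also have "\<dots> \<le> 0"
    using ge by (intro mult_nonneg_nonpos) auto
  finally have le: "(a * c' - a' * c)\<^sup>2 + (a * d' - a' * d)\<^sup>2 + a'\<^sup>2 * (a * b - c\<^sup>2 - d\<^sup>2) \<le> 0" .
  moreover have "a'\<^sup>2 * (a * b - c\<^sup>2 - d\<^sup>2) \<ge> 0"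
    using ab by simp
  ultimately have z: "a'\<^sup>2 * (a * b - c\<^sup>2 - d\<^sup>2) = 0" "(a * c' - a' * c)\<^sup>2 = 0" "(a * d' - a' * d)\<^sup>2 = 0"
    by (smt (verit) zero_le_power2)+
  have a': "a' = 0"
    using z(1) ab by simp
  then have "c' = 0" "d' = 0"
    using z a by simp_all
  with a' eq a show ?thesis
    by (simp add: zero_prod_def)
qed

text \<open>Two timelike vectors have positive product if they lie in the same half of the light cone. A
  timelike vector lies in one of the halves because its first coordinate cannot vanish.\<close>

lemma future_iff_lorentz_pos:
  assumes x: "x \<in> future" and y: "lorentz y y > 0"
  shows "y \<in> future \<longleftrightarrow> lorentz x y > 0"
proof -
  have pos: "lorentz x z > 0" if z: "z \<in> future" for z
  proof -
    obtain a b c d a' b' c' d' where [simp]: "x = (a, b, c, d)" "z = (a', b', c', d')"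
      by (metis prod.collapse)
    have a: "a > 0" "a * b > c\<^sup>2 + d\<^sup>2" and a': "a' > 0" "a' * b' > c'\<^sup>2 + d'\<^sup>2"
      using x z by (simp_all add: future_def lorentz_def power2_eq_square)
    have "0 \<le> (a * c' - a' * c)\<^sup>2 + (a * d' - a' * d)\<^sup>2"
      by simp
    also have "\<dots> = a\<^sup>2 * (c'\<^sup>2 + d'\<^sup>2) + a'\<^sup>2 * (c\<^sup>2 + d\<^sup>2) - 2 * (a * a') * (c * c' + d * d')"
      by (simp add: power2_eq_square algebra_simps)
    also have "\<dots> < a\<^sup>2 * (a' * b') + a'\<^sup>2 * (a * b) - 2 * (a * a') * (c * c' + d * d')"
      using a a' by (intro diff_strict_right_mono add_strict_mono mult_strict_left_mono) auto
    also have "\<dots> = (a * a') * lorentz x z"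
      by (simp add: lorentz_def power2_eq_square algebra_simps)
    finally show ?thesis
      using a(1) a'(1) by (metis mult_pos_pos zero_less_mult_pos)
  qed
  have "fst y \<noteq> 0"
  proof
    assume "fst y = 0"
    then have "lorentz y y = - (2 * (fst (snd (snd y)))\<^sup>2 + 2 * (snd (snd (snd y)))\<^sup>2)"
      by (auto simp: lorentz_def power2_eq_square split: prod.splits)
    with y show False
      by (smt (verit) zero_le_power2)
  qed
  then consider "y \<in> future" | "- y \<in> future"
    using y bilinear_lorentz
    by (auto simp: future_def bilinear_lneg bilinear_rneg linorder_neq_iff)
  then show ?thesis
  proof cases
    case 2
    then have "lorentz x y < 0"
      using pos[of "- y"] by (simp add: bilinear_rneg[OF bilinear_lorentz])
    with 2 show ?thesis
      by (auto simp: future_def)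
  qed (use pos in auto)
qed

text \<open>Gram--Schmidt for a form that is definite only on the subspace projected to: the induction step
  makes the new vector orthogonal to the old span and then projects along it. If the new vector was
  already in the old span, its corrected version is \<open>0\<close>, and the default value of division by zero
  gives the right coefficient.\<close>

lemma orthogonal_projection_definite:
  fixes f :: "'b::real_vector \<Rightarrow> 'b \<Rightarrow> real"
  assumes f: "bilinear f" and sym: "\<And>x y. f x y = f y x"
    and S: "finite S" and definite: "\<And>s. s \<in> span S \<Longrightarrow> f s s = 0 \<Longrightarrow> s = 0"
  shows "\<exists>p\<in>span S. \<forall>s\<in>span S. f (x - p) s = 0"
  using S definite
proof (induction S arbitrary: x)
  case empty
  then show ?case
    using f by (auto simp: bilinear_rzero)
next
  case (insert a S)
  have sub: "span S \<subseteq> span (insert a S)"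
    by (simp add: span_mono subset_insertI)
  have IH: "\<exists>p\<in>span S. \<forall>s\<in>span S. f (y - p) s = 0" for y
    using insert.IH insert.prems sub by blast
  obtain a0 where a0: "a0 \<in> span S" "\<And>s. s \<in> span S \<Longrightarrow> f (a - a0) s = 0"
    using IH by blast
  obtain p where p: "p \<in> span S" "\<And>s. s \<in> span S \<Longrightarrow> f (x - p) s = 0"
    using IH by blast
  define n where "n = a - a0"
  define t where "t = f (x - p) n / f n n"
  have n: "n \<in> span (insert a S)"
    unfolding n_def using a0 sub by (intro span_diff) (auto intro: span_base)
  have t: "f (x - p) n = t * f n n"
    using insert.prems[OF n] bilinear_rzero[OF f] by (auto simp: t_def)
  show ?case
  proof (intro bexI ballI)
    show "p + t *\<^sub>R n \<in> span (insert a S)"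
      using p n sub by (intro span_add span_scale) auto
    fix s assume "s \<in> span (insert a S)"
    then obtain k where k: "s - k *\<^sub>R a \<in> span S"
      using span_breakdown_eq by blast
    define r where "r = s - k *\<^sub>R n"
    have r: "r \<in> span S"
    proof -
      have "r = (s - k *\<^sub>R a) + k *\<^sub>R a0"
        by (simp add: r_def n_def algebra_simps)
      then show ?thesis
        using k a0 by (simp add: span_add span_scale)
    qed
    have s: "s = r + k *\<^sub>R n"
      by (simp add: r_def)
    have "f (x - (p + t *\<^sub>R n)) s = f ((x - p) - t *\<^sub>R n) r + k * f ((x - p) - t *\<^sub>R n) n"
      unfolding s using f by (simp add: bilinear_radd bilinear_rmul algebra_simps)
    also have "\<dots> = 0"
      using p(2)[OF r] a0(2)[OF r] t f
      by (simp add: bilinear_lsub bilinear_lmul n_def[symmetric])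
    finally show "f (x - (p + t *\<^sub>R n)) s = 0" .
  qed
qed

section \<open>Two-forms and their classes\<close>

lemma Lambda2_simps:
  assumes "\<alpha> \<in> Lambda2"
  shows "\<alpha> (x + y) z = \<alpha> x z + \<alpha> y z" "\<alpha> (k *\<^sub>R x) z = k * \<alpha> x z" "\<alpha> (- x) z = - \<alpha> x z"
    "\<alpha> z (x + y) = \<alpha> z x + \<alpha> z y" "\<alpha> z (k *\<^sub>R x) = k * \<alpha> z x" "\<alpha> z (- x) = - \<alpha> z x"
    "\<alpha> x x = 0"
  using assms by (auto simp: Lambda2_def bilinear_ladd bilinear_lmul bilinear_lneg bilinear_radd
      bilinear_rmul bilinear_rneg)

lemma Lambda2_skew:
  assumes "\<alpha> \<in> Lambda2"
  shows "\<alpha> x y = - \<alpha> y x"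
proof -
  have "0 = \<alpha> (x + y) (x + y)"
    by (simp only: Lambda2_simps(7)[OF assms])
  also have "\<dots> = \<alpha> x y + \<alpha> y x"
    by (simp only: Lambda2_simps(1,4)[OF assms]) (simp add: Lambda2_simps(7)[OF assms])
  finally show ?thesis by simp
qed

lemma Lambda2I:
  assumes "\<And>x y z. \<alpha> (x + y) z = \<alpha> x z + \<alpha> y z" "\<And>k x z. \<alpha> (k *\<^sub>R x) z = k * \<alpha> x z"
    "\<And>x y z. \<alpha> z (x + y) = \<alpha> z x + \<alpha> z y" "\<And>k x z. \<alpha> z (k *\<^sub>R x) = k * \<alpha> z x"
    "\<And>x. \<alpha> x x = 0"
  shows "\<alpha> \<in> Lambda2"
proof -
  have "bilinear \<alpha>"
    unfolding bilinear_def by (auto intro!: linearI simp: assms)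
  then show ?thesis
    using assms by (simp add: Lambda2_def)
qed

lemma Lambda2_lincomb:
  assumes "\<alpha> \<in> Lambda2" "\<beta> \<in> Lambda2"
  shows "(\<lambda>x y. s * \<alpha> x y + t * \<beta> x y) \<in> Lambda2"
  by (rule Lambda2I) (simp_all add: Lambda2_simps assms algebra_simps)

lemma closed2_lincomb:
  assumes "\<alpha> \<in> closed2 br" "\<beta> \<in> closed2 br"
  shows "(\<lambda>x y. s * \<alpha> x y + t * \<beta> x y) \<in> closed2 br"
proof -
  have "d2 br (\<lambda>x y. s * \<alpha> x y + t * \<beta> x y) = (\<lambda>x y z. s * d2 br \<alpha> x y z + t * d2 br \<beta> x y z)"
    by (simp add: d2_def fun_eq_iff algebra_simps)
  then show ?thesis
    using assms Lambda2_lincomb[of \<alpha> \<beta> s t] by (simp add: closed2_def zero_fun_def)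
qed

lemma lie_bracket_skew:
  assumes "lie_bracket br"
  shows "br x y = - br y x"
proof -
  have bil: "bilinear br" and alt: "br z z = 0" for z
    using assms by (auto simp: lie_bracket_def)
  have "0 = br (x + y) (x + y)"
    by (simp only: alt)
  also have "\<dots> = br x y + br y x"
    by (simp only: bilinear_ladd[OF bil] bilinear_radd[OF bil]) (simp add: alt)
  finally show ?thesis
    by (simp add: eq_neg_iff_add_eq_0)
qed

lemma d1_closed:
  assumes br: "lie_bracket br" and \<phi>: "linear \<phi>"
  shows "d1 br \<phi> \<in> closed2 br"
proof -
  have bil: "bilinear br" and alt: "br x x = 0" 
    and jac: "br x (br y z) + br y (br z x) + br z (br x y) = 0" for x y z
    using br by (auto simp: lie_bracket_def)
  note skew = lie_bracket_skew[OF br]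
  have "d1 br \<phi> \<in> Lambda2"
    using \<phi> bil alt
    by (intro Lambda2I) (simp_all add: d1_def bilinear_ladd bilinear_lmul bilinear_radd bilinear_rmul
        linear_add linear_scale linear_0)
  moreover have "d2 br (d1 br \<phi>) x y z = 0" for x y z
  proof -
    have "d2 br (d1 br \<phi>) x y z = \<phi> (br (br x y) z - br (br x z) y + br (br y z) x)"
      using \<phi> by (simp add: d2_def d1_def linear_add linear_diff)
    also have "br (br x y) z - br (br x z) y + br (br y z) x = - (br x (br y z) + br y (br z x) + br z (br x y))"
      using skew[of "br x y" z] skew[of "br x z" y] skew[of "br y z" x] skew[of z x] bil
      by (simp add: bilinear_rneg)
    finally show ?thesis
      using jac \<phi> by (simp add: linear_0)
  qed
  ultimately show ?thesis
    by (simp add: closed2_def fun_eq_iff)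
qed

text \<open>Orientation elements are prescribed on \<open>Lambda4\<close> alone, so they can be evaluated on wedge
  products only with this.\<close>

lemma wedge22_Lambda4:
  assumes "\<alpha> \<in> Lambda2" "\<beta> \<in> Lambda2"
  shows "wedge22 \<alpha> \<beta> \<in> Lambda4"
  unfolding Lambda4_def
proof (intro CollectI conjI allI)
  note s = Lambda2_skew[OF assms(1)] Lambda2_skew[OF assms(2)]
  fix p q r
  show "wedge22 \<alpha> \<beta> p p q r = 0"  "wedge22 \<alpha> \<beta> p q q r = 0"  "wedge22 \<alpha> \<beta> p q r r = 0"
    using s[of p q] s[of p r] s[of q r] by (simp_all add: wedge22_def Lambda2_simps assms algebra_simps)
qed (auto intro!: linearI simp: wedge22_def Lambda2_simps assms algebra_simps)

lemma mem_cls_self: "\<alpha> \<in> closed2 br \<Longrightarrow> \<alpha> \<in> cls br \<alpha>"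
  using equiv_class_self[OF equiv_cohomologous] by (simp add: cls_def)

lemma cls_eq_exact:
  assumes "\<alpha> \<in> closed2 br" "\<beta> \<in> closed2 br" "linear \<phi>" "\<beta> = \<alpha> + d1 br \<phi>"
  shows "cls br \<beta> = cls br \<alpha>"
proof -
  have "(\<alpha>, \<beta>) \<in> cohomologous br"
    using assms by (auto simp: cohomologous_def)
  then show ?thesis
    unfolding cls_def by (metis equiv_class_eq[OF equiv_cohomologous])
qed

lemma topspace_H2_topology: "topspace (H2_topology br) = H2 br"
  using quotient_imp_surjective_map[OF quotient_map_cls, of br]
  by (auto simp: H2_def quotient_def cls_def)

lemma clopen_connected_component:
  assumes conn: "connectedin X C" and clopen: "openin X C" "closedin X C" and ne: "C \<noteq> {}"
  shows "C \<in> connected_components_of X"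
proof -
  obtain x where x: "x \<in> C"
    using ne by blast
  let ?K = "connected_component_of_set X x"
  have "C \<subseteq> ?K"
    using connected_component_of_maximal[OF conn x] .
  moreover have "?K \<subseteq> C \<or> disjnt ?K C"
    using connectedin_clopen_cases[OF connectedin_connected_component_of clopen(2) clopen(1)] .
  ultimately have "?K = C"
    using x by (auto simp: disjnt_def)
  moreover have "x \<in> topspace X"
    using x openin_subset[OF clopen(1)] by blast
  ultimately show ?thesis
    unfolding connected_components_of_def by blast
qed

section \<open>Closed forms as the orthogonal complement of exact forms\<close>

text \<open>The frame \<open>(u, J u, w, J w)\<close> is one that exhibits the orientation, so that evaluation on it is a
  positive multiple of the pairing with \<open>\<zeta>\<close>.\<close>

locale almost_complex_lie_algebra4 =
  fixes br :: "'a::real_vector \<Rightarrow> 'a \<Rightarrow> 'a" and J :: "'a \<Rightarrow> 'a" and u w :: 'a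
  assumes dim4: "dim (UNIV :: 'a set) = 4"
    and lie: "lie_bracket br"
    and unimodular: "unimodular br"
    and almost_complex: "almost_complex J"
    and span_frame: "span {u, J u, w, J w} = UNIV"
begin

definition intersection :: "'a form2 \<Rightarrow> 'a form2 \<Rightarrow> real" where
  "intersection \<alpha> \<beta> = wedge22 \<alpha> \<beta> u (J u) w (J w)"

lemma frame_card: "card {u, J u, w, J w} = 4" and frame_independent: "independent {u, J u, w, J w}"
proof -
  have le: "card {u, J u, w, J w} \<le> 4"
    using card_length[of "[u, J u, w, J w]"] by simp
  have "dim {u, J u, w, J w} = 4"
    using dim4 span_frame by (metis dim_span)
  moreover have "dim {u, J u, w, J w} \<le> card {u, J u, w, J w}"
    by (rule dim_le_card') simp
  ultimately show "card {u, J u, w, J w} = 4"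
    using le by simp
  moreover obtain C where C: "C \<subseteq> {u, J u, w, J w}" "independent C" "{u, J u, w, J w} \<subseteq> span C"
    using maximal_independent_subset by blast
  moreover have "card C = dim (UNIV :: 'a set)"
    using C span_minimal[OF C(3) subspace_span] span_frame by (intro basis_card_eq_dim) auto
  ultimately have "C = {u, J u, w, J w}"
    using dim4 by (intro card_subset_eq) auto
  with C show "independent {u, J u, w, J w}"
    by simp
qed

lemma frame_distinct:
  "u \<noteq> J u" "u \<noteq> w" "u \<noteq> J w" "J u \<noteq> w" "J u \<noteq> J w" "w \<noteq> J w"
  using frame_card by (auto simp: card_insert_if split: if_splits)

definition coord :: "'a \<Rightarrow> 'a \<Rightarrow> real" where
  "coord e v = representation {u, J u, w, J w} v e"

lemma linear_coord: "linear (coord e)"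
  unfolding coord_def
  by (rule linearI)
    (simp_all add: frame_independent span_frame real_vector.representation_add real_vector.representation_scale)

lemma coord_frame: "e \<in> {u, J u, w, J w} \<Longrightarrow> coord e' e = (if e = e' then 1 else 0)"
  unfolding coord_def using real_vector.representation_basis[OF frame_independent, of e] by simp

lemma frame_expansion:
  "v = coord u v *\<^sub>R u + coord (J u) v *\<^sub>R J u + coord w v *\<^sub>R w + coord (J w) v *\<^sub>R J w"
proof -
  have "(\<Sum>b\<in>{u, J u, w, J w}. representation {u, J u, w, J w} v b *\<^sub>R b) = v"
    by (rule real_vector.sum_representation_eq[OF frame_independent]) (auto simp: span_frame)
  then show ?thesis
    using frame_distinct by (simp add: coord_def add.assoc)
qed

lemma trace_ad:
  "coord u (br \<xi> u) + coord (J u) (br \<xi> (J u)) + coord w (br \<xi> w) + coord (J w) (br \<xi> (J w)) = 0"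
proof -
  have "linear (br \<xi>)"
    using lie by (simp add: lie_bracket_def bilinear_def)
  then have "lin_trace (br \<xi>) = (\<Sum>b\<in>{u, J u, w, J w}. representation {u, J u, w, J w} (br \<xi> b) b)"
    by (intro lin_trace_eq frame_independent span_frame) auto
  then show ?thesis
    using unimodular frame_distinct by (simp add: unimodular_def coord_def add.assoc)
qed

lemmas bracket_skew = lie_bracket_skew[OF lie]

text \<open>Since \<open>d\<close> vanishes on 3-forms of a unimodular algebra, \<open>0 = d(\<phi> \<and> \<alpha>) = d\<phi> \<and> \<alpha> - \<phi> \<and> d\<alpha>\<close>. The
  right-hand side below is \<open>\<phi> \<and> d\<alpha>\<close> on the frame. Expanding all brackets in the frame makes the claim
  a polynomial identity in the structure constants, modulo the four linear relations
  \<open>tr(ad e) = 0\<close> for \<open>e\<close> in the frame.\<close>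

lemma intersection_exact:
  assumes \<phi>: "linear \<phi>" and \<alpha>: "\<alpha> \<in> Lambda2"
  shows "intersection (d1 br \<phi>) \<alpha> =
      \<phi> u * d2 br \<alpha> (J u) w (J w) - \<phi> (J u) * d2 br \<alpha> u w (J w)
    + \<phi> w * d2 br \<alpha> u (J u) (J w) - \<phi> (J w) * d2 br \<alpha> u (J u) w"
proof -
  have \<phi>_exp: "\<phi> v = coord u v * \<phi> u + coord (J u) v * \<phi> (J u) + coord w v * \<phi> w + coord (J w) v * \<phi> (J w)" for v
    by (subst frame_expansion[of v]) (simp add: \<phi> linear_add linear_scale)
  have \<alpha>_exp: "\<alpha> v x = coord u v * \<alpha> u x + coord (J u) v * \<alpha> (J u) x + coord w v * \<alpha> w x + coord (J w) v * \<alpha> (J w) x" for v x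
    by (subst frame_expansion[of v]) (simp add: Lambda2_simps[OF \<alpha>])
  have cneg: "coord e (- v) = - coord e v" for e v
    by (simp add: linear_coord linear_neg)
  have br0: "br x x = 0" for x
    using lie by (simp add: lie_bracket_def)
  note sk = bracket_skew[of "J u" u] bracket_skew[of w u] bracket_skew[of "J w" u]
     bracket_skew[of w "J u"] bracket_skew[of "J w" "J u"] bracket_skew[of "J w" w]
  note ask = Lambda2_skew[OF \<alpha>, of "J u" u] Lambda2_skew[OF \<alpha>, of w u] Lambda2_skew[OF \<alpha>, of "J w" u]
     Lambda2_skew[OF \<alpha>, of w "J u"] Lambda2_skew[OF \<alpha>, of "J w" "J u"] Lambda2_skew[OF \<alpha>, of "J w" w]
  have c0: "coord e 0 = 0" for e by (simp add: linear_coord linear_0)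
  \<comment> \<open>the unimodularity relations, solved for four of the structure constants\<close>
  have tr:
   "coord (J w) (br u (J w)) = - coord (J u) (br u (J u)) - coord w (br u w)"
   "coord (J w) (br (J u) (J w)) = coord u (br u (J u)) - coord w (br (J u) w)"
   "coord (J w) (br w (J w)) = coord u (br u w) + coord (J u) (br (J u) w)"
   "coord w (br w (J w)) = - coord u (br u (J w)) - coord (J u) (br (J u) (J w))"
    using trace_ad[of u] trace_ad[of "J u"] trace_ad[of w] trace_ad[of "J w"]
    by (simp_all add: br0 sk cneg c0)
  show ?thesis
    unfolding intersection_def wedge22_def d1_def d2_def
    unfolding \<phi>_exp[of "br _ _"] \<alpha>_exp[of "br _ _"] ask tr Lambda2_simps(7)[OF \<alpha>]
    by algebra
qed

lemma d2_skew:
  assumes "\<alpha> \<in> Lambda2"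
  shows "d2 br \<alpha> y x z = - d2 br \<alpha> x y z" "d2 br \<alpha> x z y = - d2 br \<alpha> x y z"
    using bracket_skew[of y x] bracket_skew[of z y]
    by (simp_all add: d2_def Lambda2_simps[OF assms])

text \<open>In \<open>intersection_exact\<close>, choosing for \<open>\<phi>\<close> the four functionals dual to the frame recovers
  all components of \<open>d\<alpha>\<close>, so orthogonality to exact forms is not only necessary for \<open>\<alpha>\<close> to be closed
  but also sufficient.\<close>

lemma closed2_iff:
  assumes \<alpha>: "\<alpha> \<in> Lambda2"
  shows "\<alpha> \<in> closed2 br \<longleftrightarrow> (\<forall>\<phi>. linear \<phi> \<longrightarrow> intersection (d1 br \<phi>) \<alpha> = 0)"
proof
  assume "\<alpha> \<in> closed2 br"
  then show "\<forall>\<phi>. linear \<phi> \<longrightarrow> intersection (d1 br \<phi>) \<alpha> = 0"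
    using \<alpha> by (simp add: intersection_exact closed2_def)
next
  assume orth: "\<forall>\<phi>. linear \<phi> \<longrightarrow> intersection (d1 br \<phi>) \<alpha> = 0"
  have bil: "bilinear br"
    using lie by (simp add: lie_bracket_def)
  let ?D = "d2 br \<alpha>"
  have base: "?D (J u) w (J w) = 0" "?D u w (J w) = 0" "?D u (J u) (J w) = 0" "?D u (J u) w = 0"
    using orth[rule_format, OF linear_coord, of u] orth[rule_format, OF linear_coord, of "J u"]
       orth[rule_format, OF linear_coord, of w] orth[rule_format, OF linear_coord, of "J w"]
       frame_distinct
    by (simp_all add: intersection_exact[OF linear_coord \<alpha>] coord_frame)
  \<comment> \<open>\<open>d\<alpha>\<close> is alternating, so its values on four increasing frame triples determine it\<close>
  have perm: "?D x y z = 0 \<Longrightarrow> ?D x z y = 0 \<and> ?D y x z = 0 \<and> ?D y z x = 0 \<and> ?D z x y = 0 \<and> ?D z y x = 0" for x y z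
    using d2_skew[OF \<alpha>] by (metis neg_equal_0_iff_equal)
  have diag: "?D x x y = 0 \<and> ?D x y x = 0 \<and> ?D y x x = 0" for x y
    using d2_skew[OF \<alpha>, of x x y] d2_skew[OF \<alpha>] by (smt (verit))
  let ?B = "{u, J u, w, J w}"
  have frame0: "?D x y z = 0" if "x \<in> ?B" "y \<in> ?B" "z \<in> ?B" for x y z
    using that by (auto simp: diag base base[THEN perm])
  have lin: "linear (\<lambda>x. ?D x y z)" "linear (\<lambda>y. ?D x y z)" "linear (\<lambda>z. ?D x y z)" for x y z
    unfolding d2_def
    by (rule linearI; simp only: Lambda2_simps[OF \<alpha>] bilinear_ladd[OF bil] bilinear_radd[OF bil]
        bilinear_lmul[OF bil] bilinear_rmul[OF bil] real_scaleR_def; algebra)+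
  have on_span: "f x = 0" if "linear f" "\<And>e. e \<in> ?B \<Longrightarrow> f e = 0" for f :: "'a \<Rightarrow> real" and x
    by (rule linear_eq_0_on_span[where b = ?B]) (use that span_frame in auto)
  have "?D x y z = 0" for x y z
    by (rule on_span[OF lin(1)], rule on_span[OF lin(2)], rule on_span[OF lin(3)], rule frame0)
  then show "\<alpha> \<in> closed2 br"
    using \<alpha> by (simp add: closed2_def fun_eq_iff)
qed

section \<open>The invariant and anti-invariant parts of a two-form\<close>

lemma J_J: "J (J v) = - v" and linear_J: "linear J"
  using almost_complex by (auto simp: almost_complex_def)

text \<open>The values on the frame of the \<open>J\<close>-invariant part of \<open>\<alpha>\<close>: the diagonal entries and the off-diagonal
  real and imaginary parts of the associated Hermitian form.\<close>

definition invariant_coords :: "'a form2 \<Rightarrow> real \<times> real \<times> real \<times> real" where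
  "invariant_coords \<alpha> = (\<alpha> u (J u), \<alpha> w (J w),
     (\<alpha> u w + \<alpha> (J u) (J w)) / 2, (\<alpha> u (J w) - \<alpha> (J u) w) / 2)"

text \<open>The same for the \<open>J\<close>-anti-invariant part, which vanishes on \<open>(u, J u)\<close> and \<open>(w, J w)\<close>.\<close>

definition anti_coords :: "'a form2 \<Rightarrow> real \<times> real" where
  "anti_coords \<alpha> = ((\<alpha> u w - \<alpha> (J u) (J w)) / 2, (\<alpha> u (J w) + \<alpha> (J u) w) / 2)"

text \<open>The orthogonal splitting \<open>\<Lambda>\<^sup>2 = \<Lambda>\<^sup>+ \<oplus> \<Lambda>\<^sup>-\<close>, with the Lorentzian and the positive definite summand.\<close>

lemma intersection_split:
  "intersection \<alpha> \<beta> = lorentz (invariant_coords \<alpha>) (invariant_coords \<beta>)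
     + 2 * (anti_coords \<alpha> \<bullet> anti_coords \<beta>)"
  unfolding intersection_def wedge22_def lorentz_def invariant_coords_def anti_coords_def
    inner_prod_def prod.case fst_conv snd_conv inner_real_def
  by (simp add: field_simps)

lemma Lambda_plus_anti_coords:
  assumes "\<alpha> \<in> Lambda_plus J" shows "anti_coords \<alpha> = 0"
proof -
  have inv: "\<alpha> (J x) (J y) = \<alpha> x y" and \<alpha>: "\<alpha> \<in> Lambda2" for x y
    using assms by (auto simp: Lambda_plus_def)
  show ?thesis
    using inv[of u w] inv[of u "J w"]
    by (simp add: anti_coords_def zero_prod_def J_J Lambda2_simps[OF \<alpha>])
qed

lemma intersection_plus:
  "\<alpha> \<in> Lambda_plus J \<Longrightarrow> intersection \<alpha> \<beta> = lorentz (invariant_coords \<alpha>) (invariant_coords \<beta>)"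
  by (simp add: intersection_split Lambda_plus_anti_coords)

lemma Lambda_minus_taming:
  assumes "\<alpha> \<in> Lambda_minus J" shows "\<alpha> v (J v) = 0"
proof -
  have inv: "\<alpha> (J x) (J y) = - \<alpha> x y" and \<alpha>: "\<alpha> \<in> Lambda2" for x y
    using assms by (auto simp: Lambda_minus_def)
  show ?thesis
    using inv[of v "J v"] Lambda2_skew[OF \<alpha>, of "J v" v]
    by (simp add: J_J Lambda2_simps[OF \<alpha>])
qed

definition invariant_part :: "'a form2 \<Rightarrow> 'a form2" where
  "invariant_part \<alpha> = (\<lambda>x y. (\<alpha> x y + \<alpha> (J x) (J y)) / 2)"

definition anti_invariant_part :: "'a form2 \<Rightarrow> 'a form2" where
  "anti_invariant_part \<alpha> = (\<lambda>x y. (\<alpha> x y - \<alpha> (J x) (J y)) / 2)"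

lemma invariant_part_mem:
  assumes \<alpha>: "\<alpha> \<in> Lambda2"
  shows "invariant_part \<alpha> \<in> Lambda_plus J"
proof -
  have "invariant_part \<alpha> \<in> Lambda2"
    by (rule Lambda2I)
       (simp_all add: invariant_part_def linear_J linear_add linear_scale Lambda2_simps[OF \<alpha>] field_simps)
  then show ?thesis
    by (simp add: Lambda_plus_def invariant_part_def J_J Lambda2_simps[OF \<alpha>] add.commute)
qed

lemma anti_invariant_part_mem:
  assumes \<alpha>: "\<alpha> \<in> Lambda2"
  shows "anti_invariant_part \<alpha> \<in> Lambda_minus J"
proof -
  have "anti_invariant_part \<alpha> \<in> Lambda2"
    by (rule Lambda2I)
       (simp_all add: anti_invariant_part_def linear_J linear_add linear_scale Lambda2_simps[OF \<alpha>] field_simps)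
  then show ?thesis
    by (simp add: Lambda_minus_def anti_invariant_part_def J_J Lambda2_simps[OF \<alpha>] field_simps)
qed

lemma invariant_coords_invariant_part:
  assumes \<alpha>: "\<alpha> \<in> Lambda2"
  shows "invariant_coords (invariant_part \<alpha>) = invariant_coords \<alpha>"
  using Lambda2_skew[OF \<alpha>, of "J u" u] Lambda2_skew[OF \<alpha>, of "J w" w]
  by (simp add: invariant_coords_def invariant_part_def J_J Lambda2_simps[OF \<alpha>] field_simps)

lemma taming_value:
  assumes \<alpha>: "\<alpha> \<in> Lambda2" and K: "invariant_coords \<alpha> = (a, b, c, d)"
    and v: "v = x *\<^sub>R u + y *\<^sub>R J u + z *\<^sub>R w + t *\<^sub>R J w"
  shows "\<alpha> v (J v) = a * (x\<^sup>2 + y\<^sup>2) + b * (z\<^sup>2 + t\<^sup>2) + 2 * c * (y * z - x * t) + 2 * d * (x * z + t * y)"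
proof -
  have Jv: "J v = x *\<^sub>R J u - y *\<^sub>R u + z *\<^sub>R J w - t *\<^sub>R w"
    unfolding v by (simp add: linear_J linear_add linear_scale J_J)
  have abcd: "a = \<alpha> u (J u)" "b = \<alpha> w (J w)" "c = (\<alpha> u w + \<alpha> (J u) (J w)) / 2" "d = (\<alpha> u (J w) - \<alpha> (J u) w) / 2"
    using K by (simp_all add: invariant_coords_def)
  note ask = Lambda2_skew[OF \<alpha>, of "J u" u] Lambda2_skew[OF \<alpha>, of w u] Lambda2_skew[OF \<alpha>, of "J w" u]
     Lambda2_skew[OF \<alpha>, of w "J u"] Lambda2_skew[OF \<alpha>, of "J w" "J u"] Lambda2_skew[OF \<alpha>, of "J w" w]
  show ?thesis
    unfolding Jv unfolding v diff_conv_add_uminus Lambda2_simps[OF \<alpha>] ask abcd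
    by (simp add: field_simps power2_eq_square)
qed

text \<open>Positivity of the Hermitian form \<open>v \<mapsto> \<alpha>(v, J v)\<close> is Sylvester's criterion for its
  \<open>2 \<times> 2\<close> matrix: \<open>a > 0\<close> and \<open>a b > c\<^sup>2 + d\<^sup>2\<close>.\<close>

lemma taming_iff_future:
  assumes \<alpha>: "\<alpha> \<in> Lambda2"
  shows "(\<forall>v. v \<noteq> 0 \<longrightarrow> \<alpha> v (J v) > 0) \<longleftrightarrow> invariant_coords \<alpha> \<in> future"
proof -
  obtain a b c d where K: "invariant_coords \<alpha> = (a, b, c, d)"
    by (metis prod.collapse)
  have fut: "invariant_coords \<alpha> \<in> future \<longleftrightarrow> a > 0 \<and> a * b > c\<^sup>2 + d\<^sup>2"
    by (auto simp: K future_def lorentz_def power2_eq_square)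
  show ?thesis
    unfolding fut
  proof (intro iffI conjI allI impI)
    assume tame: "\<forall>v. v \<noteq> 0 \<longrightarrow> \<alpha> v (J v) > 0"
    have "u \<noteq> 0"
      using frame_independent dependent_zero by blast
    then show a: "a > 0"
      using tame K by (auto simp: invariant_coords_def)
    \<comment> \<open>the minimiser of the Hermitian form among vectors with second component \<open>a\<close>; its value
      is \<open>a\<close> times the determinant\<close>
    define v where "v = (- d) *\<^sub>R u + (- c) *\<^sub>R J u + a *\<^sub>R w + 0 *\<^sub>R J w"
    have "coord w v = a"
      using frame_distinct by (simp add: v_def linear_coord linear_add linear_diff linear_scale linear_neg coord_frame)
    then have "v \<noteq> 0"
      using a linear_0[OF linear_coord] by auto
    then have "0 < \<alpha> v (J v)"
      using tame by blast
    also have "\<dots> = a * (a * b - (c\<^sup>2 + d\<^sup>2))"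
      by (simp add: taming_value[OF \<alpha> K v_def] power2_eq_square algebra_simps)
    finally show "c\<^sup>2 + d\<^sup>2 < a * b"
      using a by (simp add: zero_less_mult_iff)
  next
    fix v :: 'a assume ab: "a > 0 \<and> a * b > c\<^sup>2 + d\<^sup>2" and "v \<noteq> 0"
    define x y z t where xyzt: "x = coord u v" "y = coord (J u) v" "z = coord w v" "t = coord (J w) v"
    have v: "v = x *\<^sub>R u + y *\<^sub>R J u + z *\<^sub>R w + t *\<^sub>R J w"
      unfolding xyzt by (rule frame_expansion)
    \<comment> \<open>completing the square\<close>
    have eq: "a * \<alpha> v (J v) = (a * x + d * z - c * t)\<^sup>2 + (a * y + c * z + d * t)\<^sup>2
        + (a * b - (c\<^sup>2 + d\<^sup>2)) * (z\<^sup>2 + t\<^sup>2)"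
      by (simp add: taming_value[OF \<alpha> K v] power2_eq_square algebra_simps)
    have "a * \<alpha> v (J v) > 0"
    proof (cases "z = 0 \<and> t = 0")
      case True
      then have "x \<noteq> 0 \<or> y \<noteq> 0"
        using v \<open>v \<noteq> 0\<close> by auto
      then have "(a * x)\<^sup>2 + (a * y)\<^sup>2 > 0"
        using ab by (simp add: sum_power2_gt_zero_iff)
      then show ?thesis
        using True by (simp add: eq)
    next
      case False
      then have "(a * b - (c\<^sup>2 + d\<^sup>2)) * (z\<^sup>2 + t\<^sup>2) > 0"
        using ab by (simp add: sum_power2_gt_zero_iff)
      then show ?thesis
        unfolding eq by (smt (verit) zero_le_power2)
    qed
    then show "\<alpha> v (J v) > 0"
      using ab by (simp add: zero_less_mult_iff)
  qed
qed

lemma compatible_form_iff_future: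
  "compatible_form br J \<alpha> \<longleftrightarrow> \<alpha> \<in> closed2 br \<inter> Lambda_plus J \<and> invariant_coords \<alpha> \<in> future"
  using taming_iff_future[of \<alpha>]
  by (auto simp: compatible_form_def tamed_form_def closed2_def)

section \<open>Splitting a taming form\<close>

text \<open>This says that the Lorentzian form is negative definite on the invariant parts of exact forms. An
  exact form is isotropic, so nonnegativity of the first summand in \<open>intersection_split\<close> kills its
  anti-invariant part; the form is then invariant and orthogonal to the timelike invariant part of
  the closed form \<open>\<omega>\<close>.\<close>

lemma exact_invariant_coords_eq_0:
  assumes \<omega>: "tamed_form br J \<omega>" and \<phi>: "linear \<phi>"
    and nonneg: "lorentz (invariant_coords (d1 br \<phi>)) (invariant_coords (d1 br \<phi>)) \<ge> 0"
  shows "invariant_coords (d1 br \<phi>) = 0"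
proof -
  let ?d = "d1 br \<phi>"
  have cl: "?d \<in> closed2 br"
    using d1_closed[OF lie \<phi>] .
  then have "intersection ?d ?d = 0"
    using closed2_iff \<phi> by (auto simp: closed2_def)
  then have "anti_coords ?d \<bullet> anti_coords ?d \<le> 0"
    using nonneg unfolding intersection_split by linarith
  then have anti: "anti_coords ?d = 0"
    by (metis inner_eq_zero_iff inner_ge_zero order_antisym)
  have \<omega>2: "\<omega> \<in> Lambda2" "\<omega> \<in> closed2 br" and fut: "invariant_coords \<omega> \<in> future"
    using \<omega> taming_iff_future[of \<omega>] by (auto simp: tamed_form_def closed2_def)
  have "intersection ?d \<omega> = 0"
    using closed2_iff \<phi> \<omega>2 by auto
  then have "lorentz (invariant_coords \<omega>) (invariant_coords ?d) = 0"
    by (simp add: intersection_split anti lorentz_sym)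
  then show ?thesis
    using lorentz_orthogonal_future[OF fut _ nonneg] by simp
qed

text \<open>The invariant parts of exact forms make up a subspace of the coordinate space, on which the
  preceding lemma provides the definiteness required for an orthogonal projection.\<close>

lemma exact_projection:
  assumes \<omega>: "tamed_form br J \<omega>"
  shows "\<exists>\<phi>. linear \<phi> \<and> (\<forall>\<psi>. linear \<psi> \<longrightarrow>
     lorentz (x - invariant_coords (d1 br \<phi>)) (invariant_coords (d1 br \<psi>)) = 0)"
proof -
  define W where "W = {invariant_coords (d1 br \<phi>) | \<phi>. linear \<phi>}"
  have "subspace W"
  proof (rule subspaceI)
    show "0 \<in> W"
      unfolding W_def by (auto intro!: exI[of _ "\<lambda>_. 0"] linearI simp: invariant_coords_def d1_def zero_prod_def)
    fix p q assume "p \<in> W" "q \<in> W"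
    then obtain \<phi> \<psi> where *: "linear \<phi>" "linear \<psi>" "p = invariant_coords (d1 br \<phi>)" "q = invariant_coords (d1 br \<psi>)"
      by (auto simp: W_def)
    then have "p + q = invariant_coords (d1 br (\<lambda>x. \<phi> x + \<psi> x))"
      by (simp add: invariant_coords_def d1_def field_simps)
    with * show "p + q \<in> W"
      using linear_compose_add by (auto simp: W_def)
  next
    fix k p assume "p \<in> W"
    then obtain \<phi> where *: "linear \<phi>" "p = invariant_coords (d1 br \<phi>)"
      by (auto simp: W_def)
    then have "k *\<^sub>R p = invariant_coords (d1 br (\<lambda>x. k *\<^sub>R \<phi> x))"
      by (simp add: invariant_coords_def d1_def algebra_simps)
    with * show "k *\<^sub>R p \<in> W"
      using linear_compose_scale_right by (fastforce simp: W_def)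
  qed
  moreover obtain S where S: "S \<subseteq> W" "independent S" "W \<subseteq> span S"
    using basis_exists[of W] by metis
  ultimately have W: "span S = W"
    using span_minimal[OF S(1)] by blast
  have "\<exists>p\<in>span S. \<forall>s\<in>span S. lorentz (x - p) s = 0"
  proof (rule orthogonal_projection_definite[OF bilinear_lorentz lorentz_sym])
    show "finite S"
      using S(2) by (rule independent_imp_finite)
    show "s = 0" if "s \<in> span S" "lorentz s s = 0" for s
      using that exact_invariant_coords_eq_0[OF \<omega>] unfolding W W_def by auto
  qed
  then show ?thesis
    unfolding W W_def by blast
qed

text \<open>Here \<open>d\<phi>\<close> is chosen so that its invariant part is the orthogonal projection of the invariant part of
  \<open>\<omega>\<close>. The invariant part of \<open>\<omega> - d\<phi>\<close> is then orthogonal to all exact forms and therefore closed on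
  its own, although the invariant part of a closed form need not be closed.\<close>

lemma tamed_decomposition:
  assumes \<omega>: "tamed_form br J \<omega>"
  obtains \<phi> \<alpha> \<beta> where "linear \<phi>" "compatible_form br J \<alpha>" "\<beta> \<in> closed2 br \<inter> Lambda_minus J"
    "\<omega> = (\<alpha> + \<beta>) + d1 br \<phi>"
proof -
  let ?K = invariant_coords
  obtain \<phi> where \<phi>: "linear \<phi>"
    and orth: "\<And>\<psi>. linear \<psi> \<Longrightarrow> lorentz (?K \<omega> - ?K (d1 br \<phi>)) (?K (d1 br \<psi>)) = 0"
    using exact_projection[OF \<omega>] by blast
  have \<omega>2: "\<omega> \<in> Lambda2" "\<omega> \<in> closed2 br" and fut: "?K \<omega> \<in> future"
    using \<omega> taming_iff_future[of \<omega>] by (auto simp: tamed_form_def closed2_def)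
  define \<gamma> where "\<gamma> = (\<lambda>x y. 1 * \<omega> x y + (- 1) * d1 br \<phi> x y)"
  have \<gamma>: "\<gamma> \<in> closed2 br"
    unfolding \<gamma>_def by (rule closed2_lincomb[OF \<omega>2(2) d1_closed[OF lie \<phi>]])
  then have \<gamma>2: "\<gamma> \<in> Lambda2"
    by (simp add: closed2_def)
  let ?\<alpha> = "invariant_part \<gamma>" and ?\<beta> = "anti_invariant_part \<gamma>"
  have \<alpha>: "?\<alpha> \<in> Lambda_plus J" "?\<alpha> \<in> Lambda2"
    using invariant_part_mem[OF \<gamma>2] by (auto simp: Lambda_plus_def)
  have K\<alpha>: "?K ?\<alpha> = ?K \<omega> - ?K (d1 br \<phi>)"
    unfolding invariant_coords_invariant_part[OF \<gamma>2]
    by (simp add: \<gamma>_def invariant_coords_def field_simps)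
  have "intersection (d1 br \<psi>) ?\<alpha> = 0" if "linear \<psi>" for \<psi>
    using orth[OF that] K\<alpha> by (simp add: intersection_split Lambda_plus_anti_coords[OF \<alpha>(1)] lorentz_sym)
  then have \<alpha>cl: "?\<alpha> \<in> closed2 br"
    using closed2_iff[OF \<alpha>(2)] by blast
  have pos: "lorentz (?K ?\<alpha>) (?K ?\<alpha>) > 0 \<and> lorentz (?K \<omega>) (?K ?\<alpha>) > 0"
  proof -
    let ?p = "?K (d1 br \<phi>)"
    have 1: "lorentz (?K ?\<alpha>) ?p = 0"
      using orth[OF \<phi>] K\<alpha> by simp
    have "lorentz ?p ?p \<le> 0"
    proof (rule ccontr)
      assume neg: "\<not> ?thesis"
      then have "?p = 0"
        by (intro exact_invariant_coords_eq_0[OF \<omega> \<phi>]) simp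
      with neg show False
        by (simp add: bilinear_rzero[OF bilinear_lorentz])
    qed
    moreover have "lorentz (?K \<omega>) (?K \<omega>) > 0"
      using fut by (simp add: future_def)
    moreover have "lorentz (?K \<omega>) ?p = lorentz ?p ?p"
      using 1 unfolding K\<alpha> by (simp add: bilinear_lsub[OF bilinear_lorentz])
    ultimately show ?thesis
      unfolding K\<alpha> 
      by (simp add: bilinear_lsub[OF bilinear_lorentz] bilinear_rsub[OF bilinear_lorentz] lorentz_sym[of ?p "?K \<omega>"])
  qed
  then have "?K ?\<alpha> \<in> future"
    using future_iff_lorentz_pos[OF fut] by blast
  then have "compatible_form br J ?\<alpha>"
    using taming_iff_future[OF \<alpha>(2)] \<alpha> \<alpha>cl by (simp add: compatible_form_def tamed_form_def)
  moreover have "?\<beta> = (\<lambda>x y. 1 * \<gamma> x y + (- 1) * ?\<alpha> x y)"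
    by (simp add: fun_eq_iff invariant_part_def anti_invariant_part_def field_simps)
  then have "?\<beta> \<in> closed2 br"
    using closed2_lincomb[OF \<gamma> \<alpha>cl] by metis
  moreover have "?\<beta> \<in> Lambda_minus J"
    using anti_invariant_part_mem[OF \<gamma>2] .
  moreover have "\<omega> = (?\<alpha> + ?\<beta>) + d1 br \<phi>"
    by (simp add: fun_eq_iff invariant_part_def anti_invariant_part_def \<gamma>_def field_simps)
  ultimately show ?thesis
    using that[OF \<phi>] by blast
qed

lemma tamed_cone_eq_compatible_cone_plus_H_minus:
  "tamed_cone br J = compatible_cone br J + H_minus br J"
proof (intro equalityI subsetI)
  fix e assume "e \<in> tamed_cone br J"
  then obtain \<omega> where e: "e = cls br \<omega>" and \<omega>: "tamed_form br J \<omega>"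
    by (auto simp: tamed_cone_def)
  obtain \<phi> \<alpha> \<beta> where \<phi>: "linear \<phi>" and \<alpha>: "compatible_form br J \<alpha>" and \<beta>: "\<beta> \<in> closed2 br \<inter> Lambda_minus J"
    and eq: "\<omega> = (\<alpha> + \<beta>) + d1 br \<phi>"
    using tamed_decomposition[OF \<omega>] .
  have cl: "\<alpha> \<in> closed2 br" "\<beta> \<in> closed2 br" "\<omega> \<in> closed2 br"
    using \<omega> \<alpha> \<beta> by (auto simp: compatible_form_def tamed_form_def)
  have "\<alpha> + \<beta> \<in> closed2 br"
    using closed2_lincomb[OF cl(1,2), of 1 1] by (simp add: plus_fun_def)
  then have "e = cls br \<alpha> + cls br \<beta>"
    unfolding e cls_add[OF cl(1,2)] using cls_eq_exact \<phi> eq cl by blast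
  moreover have "cls br \<alpha> \<in> compatible_cone br J" "cls br \<beta> \<in> H_minus br J"
    using \<alpha> \<beta> by (auto simp: compatible_cone_def H_minus_def)
  ultimately show "e \<in> compatible_cone br J + H_minus br J"
    by (auto simp: set_plus_def)
next
  fix e assume "e \<in> compatible_cone br J + H_minus br J"
  then obtain \<alpha> \<beta> where \<alpha>: "compatible_form br J \<alpha>" and \<beta>: "\<beta> \<in> closed2 br \<inter> Lambda_minus J"
    and e: "e = cls br \<alpha> + cls br \<beta>"
    by (auto simp: set_plus_def compatible_cone_def H_minus_def)
  have cl: "\<alpha> \<in> closed2 br" "\<beta> \<in> closed2 br"
    using \<alpha> \<beta> by (auto simp: compatible_form_def tamed_form_def)
  have "\<alpha> + \<beta> \<in> closed2 br"
    using closed2_lincomb[OF cl, of 1 1] by (simp add: plus_fun_def)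
  moreover have "(\<alpha> + \<beta>) v (J v) > 0" if "v \<noteq> 0" for v
    using that \<alpha> \<beta> by (auto simp: compatible_form_def tamed_form_def Lambda_minus_taming)
  ultimately have "tamed_form br J (\<alpha> + \<beta>)"
    by (simp add: tamed_form_def)
  then show "e \<in> tamed_cone br J"
    unfolding e cls_add[OF cl] tamed_cone_def by blast
qed

section \<open>The compatible cone as a connected component\<close>

lemma intersection_add_exact:
  assumes "\<alpha> \<in> closed2 br" "\<beta> \<in> closed2 br" "linear \<phi>" "linear \<psi>"
  shows "intersection (\<alpha> + d1 br \<phi>) (\<beta> + d1 br \<psi>) = intersection \<alpha> \<beta>"
proof -
  have sym: "intersection \<gamma> \<delta> = intersection \<delta> \<gamma>" for \<gamma> \<delta>
    by (simp add: intersection_def wedge22_def)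
  have add: "intersection (\<gamma> + \<gamma>') \<delta> = intersection \<gamma> \<delta> + intersection \<gamma>' \<delta>" for \<gamma> \<gamma>' \<delta>
    by (simp add: intersection_def wedge22_def algebra_simps)
  have orth: "intersection (d1 br \<phi>) \<gamma> = 0" if "\<gamma> \<in> closed2 br" "linear \<phi>" for \<gamma> \<phi>
    using that closed2_iff by (auto simp: closed2_def)
  have "intersection (\<alpha> + d1 br \<phi>) (\<beta> + d1 br \<psi>)
      = intersection \<alpha> \<beta> + intersection (d1 br \<psi>) \<alpha> + intersection (d1 br \<phi>) \<beta> + intersection (d1 br \<phi>) (d1 br \<psi>)"
    by (simp add: add sym[of _ "\<beta> + d1 br \<psi>"] sym[of \<beta>] sym[of "d1 br \<psi>"])
  then show ?thesis
    using assms orth d1_closed[OF lie] by simp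
qed

text \<open>The union in the definition of the pairing is a singleton because the intersection form of
  closed forms is unaffected by exact summands.\<close>

lemma pairing_cls:
  assumes \<zeta>: "\<forall>\<eta>\<in>Lambda4. \<zeta> \<eta> = c * \<eta> u (J u) w (J w)"
    and \<alpha>: "\<alpha> \<in> closed2 br" and \<beta>: "\<beta> \<in> closed2 br"
  shows "pairing \<zeta> (cls br \<alpha>) (cls br \<beta>) = c * intersection \<alpha> \<beta>"
proof -
  have "\<zeta> (wedge22 \<alpha>' \<beta>') = c * intersection \<alpha> \<beta>" if "\<alpha>' \<in> cls br \<alpha>" "\<beta>' \<in> cls br \<beta>" for \<alpha>' \<beta>'
  proof -
    obtain \<phi> \<psi> where *: "linear \<phi>" "linear \<psi>" "\<alpha>' = \<alpha> + d1 br \<phi>" "\<beta>' = \<beta> + d1 br \<psi>"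
        "\<alpha>' \<in> Lambda2" "\<beta>' \<in> Lambda2"
      using \<open>\<alpha>' \<in> cls br \<alpha>\<close> \<open>\<beta>' \<in> cls br \<beta>\<close> by (auto simp: cls_def cohomologous_def closed2_def)
    have "\<zeta> (wedge22 \<alpha>' \<beta>') = c * intersection \<alpha>' \<beta>'"
      using \<zeta> wedge22_Lambda4[OF *(5,6)] by (simp add: intersection_def)
    also have "\<dots> = c * intersection \<alpha> \<beta>"
      unfolding *(3,4) using intersection_add_exact[OF \<alpha> \<beta> *(1,2)] by simp
    finally show ?thesis .
  qed
  moreover have "\<alpha> \<in> cls br \<alpha>" "\<beta> \<in> cls br \<beta>"
    using mem_cls_self \<alpha> \<beta> by blast+
  ultimately have "(\<Union>\<alpha>'\<in>cls br \<alpha>. \<Union>\<beta>'\<in>cls br \<beta>. {\<zeta> (wedge22 \<alpha>' \<beta>')}) = {c * intersection \<alpha> \<beta>}"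
    by fastforce
  then show ?thesis
    by (simp add: pairing_def)
qed

text \<open>Compatible forms are star-shaped about \<open>\<omega>\<close>, and taking classes is continuous.\<close>

lemma connectedin_compatible_cone:
  assumes \<omega>: "compatible_form br J \<omega>"
  shows "connectedin (H2_topology br) (compatible_cone br J)"
proof -
  let ?S = "{\<alpha>. compatible_form br J \<alpha>}"
  define seg where "seg \<alpha> t = (\<lambda>x y. (1 - t) * \<omega> x y + t * \<alpha> x y)" for \<alpha> and t :: real
  have seg: "compatible_form br J (seg \<alpha> t)" if \<alpha>: "compatible_form br J \<alpha>" and t: "t \<in> {0..1}" for \<alpha> t
  proof -
    have cl: "seg \<alpha> t \<in> closed2 br"
      unfolding seg_def using closed2_lincomb \<omega> \<alpha> by (auto simp: compatible_form_def tamed_form_def)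
    moreover have "seg \<alpha> t \<in> Lambda_plus J"
      using \<omega> \<alpha> cl by (simp add: seg_def compatible_form_def Lambda_plus_def closed2_def)
    moreover have "seg \<alpha> t v (J v) > 0" if "v \<noteq> 0" for v
    proof -
      have "\<omega> v (J v) > 0" "\<alpha> v (J v) > 0"
        using \<omega> \<alpha> that by (auto simp: compatible_form_def tamed_form_def)
      then show ?thesis
        using t convex_bound_lt[of "- \<omega> v (J v)" 0 "- \<alpha> v (J v)" "1 - t" t]
        by (simp add: seg_def)
    qed
    ultimately show ?thesis
      by (simp add: compatible_form_def tamed_form_def)
  qed
  have ends: "seg \<alpha> 0 = \<omega>" "seg \<alpha> 1 = \<alpha>" for \<alpha>
    by (simp_all add: seg_def)
  have "?S = (\<Union>\<alpha>\<in>?S. seg \<alpha> ` {0..1})"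
    using seg ends by (auto simp: image_iff) (metis atLeastAtMost_iff order_refl zero_le_one)
  moreover have "connected (\<Union>\<alpha>\<in>?S. seg \<alpha> ` {0..1})"
  proof (rule connected_Union)
    show "connected s" if "s \<in> (\<lambda>\<alpha>. seg \<alpha> ` {0..1}) ` ?S" for s
      using that unfolding seg_def
      by (auto intro!: connected_continuous_image continuous_intros)
    have "\<omega> \<in> seg \<alpha> ` {0..1}" for \<alpha>
      using ends(1)[of \<alpha>] by force
    then show "\<Inter>((\<lambda>\<alpha>. seg \<alpha> ` {0..1}) ` ?S) \<noteq> {}"
      by blast
  qed
  ultimately have "connected ?S"
    by simp
  then have "connectedin (top_of_set (closed2 br)) ?S"
    by (auto simp: connectedin_subtopology compatible_form_def tamed_form_def)
  then have "connectedin (H2_topology br) (cls br ` ?S)"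
    by (rule connectedin_continuous_map_image[OF quotient_imp_continuous_map[OF quotient_map_cls]])
  moreover have "cls br ` ?S = compatible_cone br J"
    by (auto simp: compatible_cone_def)
  ultimately show ?thesis
    by simp
qed

text \<open>The sign of the pairing with \<open>[\<omega>]\<close> separates the classes of positive square in \<open>H\<^sub>J\<^sup>+\<close> into two open
  sets, according to the half of the light cone in which an invariant representative lies.\<close>

lemma compatible_cone_in_connected_components:
  assumes c: "c > 0" and \<zeta>: "\<forall>\<eta>\<in>Lambda4. \<zeta> \<eta> = c * \<eta> u (J u) w (J w)"
    and \<omega>: "compatible_form br J \<omega>"
  shows "compatible_cone br J \<in> connected_components_of
    (subtopology (H2_topology br) {e \<in> H_plus br J. pairing \<zeta> e e > 0})"
proof -
  let ?E = "{e \<in> H_plus br J. pairing \<zeta> e e > 0}"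
  let ?X = "subtopology (H2_topology br) ?E"
  let ?p = "\<lambda>e. pairing \<zeta> e (cls br \<omega>)"
  have \<omega>': "\<omega> \<in> closed2 br" "\<omega> \<in> Lambda_plus J" "invariant_coords \<omega> \<in> future"
    using \<omega> by (auto simp: compatible_form_iff_future)
  have pairing: "pairing \<zeta> (cls br \<alpha>) (cls br \<beta>) = c * intersection \<alpha> \<beta>"
    if "\<alpha> \<in> closed2 br" "\<beta> \<in> closed2 br" for \<alpha> \<beta>
    using pairing_cls[OF \<zeta> that] .
  have E_cls: "cls br \<alpha> \<in> ?E \<longleftrightarrow> lorentz (invariant_coords \<alpha>) (invariant_coords \<alpha>) > 0"
    if "\<alpha> \<in> closed2 br \<inter> Lambda_plus J" for \<alpha>
    using that c by (auto simp: H_plus_def pairing intersection_plus zero_less_mult_iff)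
  have p_cls: "?p (cls br \<alpha>) = c * lorentz (invariant_coords \<omega>) (invariant_coords \<alpha>)"
    if "\<alpha> \<in> closed2 br \<inter> Lambda_plus J" for \<alpha>
    using that \<omega>' by (simp add: pairing intersection_plus lorentz_sym)
  have cls_H2: "cls br \<alpha> \<in> H2 br" if "\<alpha> \<in> closed2 br" for \<alpha>
    using that by (auto simp: H2_def quotient_def cls_def)
  then have H_plus_sub: "H_plus br J \<subseteq> H2 br"
    by (auto simp: H_plus_def)
  have cone: "compatible_cone br J = {e \<in> ?E. ?p e > 0}"
  proof (intro equalityI subsetI)
    fix e assume "e \<in> compatible_cone br J"
    then obtain \<alpha> where \<alpha>: "e = cls br \<alpha>" "\<alpha> \<in> closed2 br \<inter> Lambda_plus J" "invariant_coords \<alpha> \<in> future"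
      by (auto simp: compatible_cone_def compatible_form_iff_future)
    then have pos: "lorentz (invariant_coords \<alpha>) (invariant_coords \<alpha>) > 0"
      by (simp add: future_def)
    then have "?p e > 0"
      using \<alpha> c p_cls future_iff_lorentz_pos[OF \<omega>'(3) pos] by simp
    then show "e \<in> {e \<in> ?E. ?p e > 0}"
      using \<alpha> E_cls pos by blast
  next
    fix e assume e: "e \<in> {e \<in> ?E. ?p e > 0}"
    then obtain \<alpha> where \<alpha>: "e = cls br \<alpha>" "\<alpha> \<in> closed2 br \<inter> Lambda_plus J"
      by (auto simp: H_plus_def)
    have pos: "lorentz (invariant_coords \<alpha>) (invariant_coords \<alpha>) > 0"
      using e \<alpha> E_cls by blast
    have "lorentz (invariant_coords \<omega>) (invariant_coords \<alpha>) > 0"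
      using e \<alpha> c p_cls by (simp add: zero_less_mult_iff)
    then have "compatible_form br J \<alpha>"
      using \<alpha> future_iff_lorentz_pos[OF \<omega>'(3) pos] by (simp add: compatible_form_iff_future)
    then show "e \<in> compatible_cone br J"
      using \<alpha> by (auto simp: compatible_cone_def)
  qed
  have nonzero: "?p e \<noteq> 0" if e: "e \<in> ?E" for e
  proof -
    obtain \<alpha> where \<alpha>: "e = cls br \<alpha>" "\<alpha> \<in> closed2 br \<inter> Lambda_plus J"
      using e by (auto simp: H_plus_def)
    have pos: "lorentz (invariant_coords \<alpha>) (invariant_coords \<alpha>) > 0"
      using e \<alpha> E_cls by blast
    then have "invariant_coords \<alpha> \<noteq> 0"
      by (auto simp: bilinear_rzero[OF bilinear_lorentz])
    then have "lorentz (invariant_coords \<omega>) (invariant_coords \<alpha>) \<noteq> 0"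
      using lorentz_orthogonal_future[OF \<omega>'(3), of "invariant_coords \<alpha>"] pos by auto
    then show ?thesis
      using c p_cls[OF \<alpha>(2)] \<alpha>(1) by simp
  qed
  have evaluation: "continuous_on (closed2 br) (\<lambda>\<alpha>. \<alpha> x y)" for x y
    by (rule continuous_on_product_then_coordinatewise[OF
          continuous_on_product_then_coordinatewise[OF continuous_on_id]])
  have cont: "continuous_on (closed2 br) (\<lambda>\<alpha>. c * intersection \<alpha> \<omega>)"
    unfolding intersection_def wedge22_def
    by (intro continuous_on_add continuous_on_diff continuous_on_mult continuous_on_const evaluation)
  \<comment> \<open>openness in the quotient topology is openness of the preimage, where the pairing is a polynomial
    in finitely many evaluations and hence continuous for pointwise convergence\<close>
  have half: "openin (H2_topology br) {e \<in> H2 br. ?p e \<in> T}" if "open T" for T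
  proof -
    have "{\<alpha> \<in> closed2 br. cls br \<alpha> \<in> {e \<in> H2 br. ?p e \<in> T}}
        = closed2 br \<inter> (\<lambda>\<alpha>. c * intersection \<alpha> \<omega>) -` T"
      using cls_H2 \<omega>' by (auto simp: pairing)
    then show ?thesis
      using continuous_openin_preimage_gen[OF cont that] by (simp add: openin_H2_topology)
  qed
  have top: "topspace ?X = ?E"
    using H_plus_sub by (auto simp: topspace_H2_topology)
  have "compatible_cone br J = ?E \<inter> {e \<in> H2 br. ?p e \<in> {0<..}}"
    using H_plus_sub by (auto simp: cone)
  then have "openin ?X (compatible_cone br J)"
    using openin_subtopology_Int2[OF half[of "{0<..}"]] by simp
  moreover have "?E - compatible_cone br J = ?E \<inter> {e \<in> H2 br. ?p e \<in> {..<0}}"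
    using H_plus_sub nonzero unfolding cone by fastforce
  then have "openin ?X (?E - compatible_cone br J)"
    using openin_subtopology_Int2[OF half[of "{..<0}"]] by simp
  then have "closedin ?X (compatible_cone br J)"
    unfolding closedin_def top using cone by blast
  moreover have "connectedin ?X (compatible_cone br J)"
    using connectedin_compatible_cone[OF \<omega>] cone by (auto simp: connectedin_subtopology)
  moreover have "compatible_cone br J \<noteq> {}"
    using \<omega> by (auto simp: compatible_cone_def)
  ultimately show ?thesis
    by (intro clopen_connected_component)
qed

end

theorem theorem0p6:
  fixes br :: "'a::real_vector \<Rightarrow> 'a \<Rightarrow> 'a"
    and J :: "'a \<Rightarrow> 'a"
    and \<zeta> :: "'a form4 \<Rightarrow> real"
  assumes "dim (UNIV :: 'a set) = 4"
    and "lie_bracket br"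
    and "unimodular br"
    and "almost_complex J"
    and "tamed br J"
    and "J_positive J \<zeta>"
  shows "compatible_cone br J \<in> connected_components_of
           (subtopology (H2_topology br) {e \<in> H_plus br J. pairing \<zeta> e e > 0})
       \<and> tamed_cone br J = compatible_cone br J + H_minus br J"
proof -
  obtain u w c where frame: "span {u, J u, w, J w} = UNIV" and c: "c > 0"
    and \<zeta>: "\<forall>\<eta>\<in>Lambda4. \<zeta> \<eta> = c * \<eta> u (J u) w (J w)"
    using assms(6) by (auto simp: J_positive_def)
  interpret almost_complex_lie_algebra4 br J u w
    using assms frame by unfold_locales
  obtain \<omega> where "tamed_form br J \<omega>"
    using assms(5) by (auto simp: tamed_def)
  then obtain \<alpha> where "compatible_form br J \<alpha>"
    by (rule tamed_decomposition)
  then show ?thesis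
    using compatible_cone_in_connected_components[OF c \<zeta>]
      tamed_cone_eq_compatible_cone_plus_H_minus by blast
qed

end
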